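(* Let $d\ge 1$ and let $\Omega\subset\mathbb{R}^d$ be a bounded open convex set with Lipschitz boundary, such that $\vec 0\in\mathrm{int}(\Omega)$, normalized so that $\vec e_d\in\partial\Omega$. Let $M$ and $\widetilde M$ be, respectively, the centered and the non-centered discrete maximal operators associated to $\Omega$ (defined in the context). (i) (Centered case) The operator $f\mapsto\nabla Mf$ is bounded and continuous from $l^1(\mathbb{Z}^d)$ to $l^1(\mathbb{Z}^d)$. That is, there is a constant $C=C(d,\Omega)<\infty$ such that $\|\nabla Mf\|_{l^1(\mathbb{Z}^d)}\le C\|f\|_{l^1(\mathbb{Z}^d)}$ for all $f\in l^1(\mathbb{Z}^d)$; and whenever $f_k\to f$ in $l^1(\mathbb{Z}^d)$ one has $\|\nabla Mf_k-\nabla Mf\|_{l^1(\mathbb{Z}^d)}\to0$ as $k\to\infty$. (ii) (Non-centered case) The operator $f\mapsto\nabla\widetilde Mf$ is bounded and continuous from $l^1(\mathbb{Z}^d)$ to $l^1(\mathbb{Z}^d)$. That is, there is a constant $C=C(d,\Omega)<\infty$ such that $\|\nabla\widetilde Mf\|_{l^1(\mathbb{Z}^d)}\le C\|f\|_{l^1(\mathbb{Z}^d)}$ for all $f\in l^1(\mathbb{Z}^d)$; and whenever $f_k\to f$ in $l^1(\mathbb{Z}^d)$ one has $\|\nabla\widetilde Mf_k-\nabla\widetilde Mf\|_{l^1(\mathbb{Z}^d)}\to0$ as $k\to\infty$.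
   Context: Functions are real-valued, $f:\mathbb{Z}^d\to\mathbb{R}$, and $\|f\|_{l^1(\mathbb{Z}^d)}=\sum_{\vec n\in\mathbb{Z}^d}|f(\vec n)|$. $\vec e_i$ denotes the $i$-th canonical basis vector. The discrete gradient is $\nabla f(\vec n)=\big(\frac{\partial f}{\partial x_1}(\vec n),\dots,\frac{\partial f}{\partial x_d}(\vec n)\big)$, where $\frac{\partial f}{\partial x_i}(\vec n):=f(\vec n+\vec e_i)-f(\vec n)$; the $l^1(\mathbb{Z}^d)$ norm of a vector field $F:\mathbb{Z}^d\to\mathbb{R}^d$ is $\sum_{\vec n}|F(\vec n)|$ with $|\cdot|$ the Euclidean norm. For $\vec x_0\in\mathbb{R}^d$ and $r>0$ put $\overline{\Omega}_r(\vec x_0)=\{\vec x\in\mathbb{Z}^d:\ r^{-1}(\vec x-\vec x_0)\in\overline{\Omega}\}$, where $\overline\Omega$ is the closure of $\Omega$; for $r=0$ put $\overline{\Omega}_0(\vec x_0)=\{\vec x_0\}$. Write $\overline{\Omega}_r=\overline{\Omega}_r(\vec 0)$. Let $N(\vec x_0,r)$ be the number of lattice points in $\overline{\Omega}_r(\vec x_0)$ and $N(r)=N(\vec 0,r)$. The centered discrete maximal operator is $$Mf(\vec n)=\sup_{r\ge0}\frac{1}{N(r)}\sum_{\vec m\in\overline{\Omega}_r}|f(\vec n+\vec m)|.$$ The non-centered discrete maximal operator is $$\widetilde Mf(\vec n)=\sup\ \frac{1}{N(\vec x_0,r)}\sum_{\vec m\in\overline{\Omega}_r(\vec x_0)}|f(\vec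 m)|,$$ where the supremum is over all $\vec x_0\in\mathbb{R}^d$ and $r\ge0$ such that $\vec n\in\overline{\Omega}_r(\vec x_0)$. *)

theory Defs
  imports "HOL-Analysis.Analysis"
begin

definition lattice_vec :: "int ^ 'd \<Rightarrow> real ^ 'd" where
  "lattice_vec x = (\<chi> i. real_of_int (x $ i))"

text \<open>Near each boundary point, after choosing the axis \<open>u\<close>, the set lies strictly above the
  graph of a Lipschitz function over the hyperplane orthogonal to \<open>u\<close>. The point \<open>y\<close> has
  height \<open>y \<bullet> u\<close> over its orthogonal projection \<open>y - (y \<bullet> u) *\<^sub>R u\<close>.\<close>

definition lipschitz_boundary :: "(real ^ 'd) set \<Rightarrow> bool" where
  "lipschitz_boundary S \<longleftrightarrow>
    (\<forall>x\<in>frontier S. \<exists>r>0. \<exists>u L g. norm u = 1 \<and> lipschitz_on L {y. y \<bullet> u = 0} g \<and>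
       S \<inter> ball x r = {y \<in> ball x r. y \<bullet> u > (g (y - (y \<bullet> u) *\<^sub>R u) :: real)})"

text \<open>The lattice points of the dilate of radius \<open>r\<close> about \<open>x0\<close>. Since only lattice points are
  collected, the case \<open>r = 0\<close> gives \<open>{x0}\<close> if \<open>x0\<close> is a lattice point and is empty otherwise.\<close>

definition dilate :: "(real ^ 'd) set \<Rightarrow> real ^ 'd \<Rightarrow> real \<Rightarrow> (int ^ 'd) set" where
  "dilate \<Omega> x0 r =
    (if r = 0 then {x. lattice_vec x = x0}
     else {x. inverse r *\<^sub>R (lattice_vec x - x0) \<in> closure \<Omega>})"

definition num_points :: "(real ^ 'd) set \<Rightarrow> real ^ 'd \<Rightarrow> real \<Rightarrow> nat" where
  "num_points \<Omega> x0 r = card (dilate \<Omega> x0 r)"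

text \<open>For bounded \<open>\<Omega>\<close> with \<open>0\<close> in its interior and bounded \<open>f\<close>, the suprema below are over
  nonempty bounded sets of averages over finite sets of lattice points.\<close>

definition centered_max :: "(real ^ 'd) set \<Rightarrow> (int ^ 'd \<Rightarrow> real) \<Rightarrow> int ^ 'd \<Rightarrow> real" where
  "centered_max \<Omega> f n =
    (SUP r\<in>{0..}. 1 / real (num_points \<Omega> 0 r) * (\<Sum>m\<in>dilate \<Omega> 0 r. \<bar>f (n + m)\<bar>))"

definition noncentered_max :: "(real ^ 'd) set \<Rightarrow> (int ^ 'd \<Rightarrow> real) \<Rightarrow> int ^ 'd \<Rightarrow> real" where
  "noncentered_max \<Omega> f n =
    (SUP (x0, r)\<in>{(x0, r). r \<ge> 0 \<and> n \<in> dilate \<Omega> x0 r}.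
       1 / real (num_points \<Omega> x0 r) * (\<Sum>m\<in>dilate \<Omega> x0 r. \<bar>f m\<bar>))"

definition discrete_grad :: "(int ^ 'd \<Rightarrow> real) \<Rightarrow> int ^ 'd \<Rightarrow> real ^ 'd" where
  "discrete_grad f n = (\<chi> i. f (n + axis i 1) - f n)"

definition in_l1 :: "('a \<Rightarrow> 'b::real_normed_vector) \<Rightarrow> bool" where
  "in_l1 F \<longleftrightarrow> (\<lambda>n. norm (F n)) summable_on UNIV"

text \<open>Meaningful only for functions satisfying \<open>in_l1\<close>: \<open>infsum\<close> is \<open>0\<close> otherwise.\<close>

definition l1_norm :: "('a \<Rightarrow> 'b::real_normed_vector) \<Rightarrow> real" where
  "l1_norm F = (\<Sum>\<^sub>\<infinity>n. norm (F n))"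

end

theory Submission imports Defs begin

text \<open>Both operators take the supremum of averages of \<open>\<bar>f\<bar>\<close> over dilates \<open>B\<close> containing \<open>n\<close>. Enlarging
  the radius of \<open>B\<close> by a constant gives an admissible \<open>B' \<supseteq> B\<close> for a neighbour of \<open>n\<close>, so a jump of
  the maximal function between neighbours is at most the sum over \<open>m \<in> B\<close> of
  \<open>\<bar>f m\<bar> * (1 / card B - 1 / card B')\<close>. Comparing a dilate of radius \<open>r\<close> with the union of the unit
  cells at its lattice points shows that it has \<open>vol * r ^ d + O(r ^ (d - 1))\<close> of them, so the weight
  is \<open>O((1 + r) ^ (- d - 1))\<close>, hence at most \<open>K (m - n)\<close> with \<open>K m = C / (1 + norm m) ^ (d + 1)\<close>
  summable. The gradient is thus dominated pointwise by a correlation of \<open>\<bar>f\<bar>\<close> with \<open>K\<close>. As this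
  majorant depends continuously on \<open>f\<close> in \<open>l1\<close> and the maximal functions converge uniformly,
  continuity follows by dominated convergence.\<close>

subsection \<open>Summation over the lattice\<close>

lemma summable_on_int_powr:
  fixes s :: real
  assumes "s < -1"
  shows "(\<lambda>k::int. (1 + \<bar>real_of_int k\<bar>) powr s) summable_on UNIV"
proof -
  let ?h = "\<lambda>k::int. (1 + \<bar>real_of_int k\<bar>) powr s"
  have "summable (\<lambda>n. real (Suc n) powr s)"
    using assms by (subst summable_Suc_iff) (simp add: summable_real_powr_iff)
  then have nat: "(\<lambda>n. (1 + real n) powr s) summable_on UNIV"
    by (intro norm_summable_imp_summable_on) (simp add: add.commute)
  have "?h summable_on range int"
    by (subst summable_on_reindex) (use nat in \<open>auto simp: o_def\<close>)
  moreover have "?h summable_on range (\<lambda>n. - int n)"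
    by (subst summable_on_reindex) (use nat in \<open>auto simp: o_def inj_on_def\<close>)
  ultimately have "?h summable_on (range int \<union> range (\<lambda>n. - int n))"
    by (rule summable_on_union)
  moreover have "range int \<union> range (\<lambda>n. - int n) = UNIV"
    by (metis (no_types, lifting) UNIV_eq_I Un_iff int_cases2 rangeI)
  ultimately show ?thesis by simp
qed

text \<open>A finite set of vectors lies in a finite box, over which the sum of the products factors
  into a power of a one-dimensional partial sum.\<close>

lemma summable_on_prod_components:
  fixes h :: "'a \<Rightarrow> real"
  assumes "h summable_on UNIV" and nonneg: "\<And>k. h k \<ge> 0"
  shows "(\<lambda>m::'a ^ 'd. \<Prod>i\<in>UNIV. h (m $ i)) summable_on UNIV"
proof (rule nonneg_bdd_above_summable_on)
  show "bdd_above (sum (\<lambda>m::'a ^ 'd. \<Prod>i\<in>UNIV. h (m $ i)) ` {F. F \<subseteq> UNIV \<and> finite F})"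
  proof (rule bdd_aboveI2)
    fix F :: "('a ^ 'd) set" assume "F \<in> {F. F \<subseteq> UNIV \<and> finite F}"
    then have "finite F" by simp
    define X where "X = (\<Union>i. (\<lambda>m. m $ i) ` F)"
    have X: "finite X" using \<open>finite F\<close> by (simp add: X_def)
    define P where "P = PiE (UNIV :: 'd set) (\<lambda>_. X)"
    have "finite P" unfolding P_def using X by (intro finite_PiE) auto
    have "F \<subseteq> vec_lambda ` P"
    proof
      fix m assume "m \<in> F"
      then have "vec_nth m \<in> P" by (auto simp: P_def X_def)
      then show "m \<in> vec_lambda ` P" by (metis image_eqI vec_nth_inverse)
    qed
    then have "(\<Sum>m\<in>F. \<Prod>i\<in>UNIV. h (m $ i)) \<le> (\<Sum>m\<in>vec_lambda ` P. \<Prod>i\<in>UNIV. h (m $ i))"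
      using \<open>finite P\<close> by (intro sum_mono2) (auto intro: prod_nonneg nonneg)
    also have "\<dots> = (\<Sum>g\<in>P. \<Prod>i\<in>UNIV. h (g i))"
      by (subst sum.reindex) (auto simp: inj_on_def vec_lambda_inject)
    also have "\<dots> = (\<Prod>i\<in>(UNIV::'d set). \<Sum>k\<in>X. h k)"
      unfolding P_def by (rule prod_sum_PiE[symmetric]) (use X in auto)
    also have "\<dots> = (\<Sum>k\<in>X. h k) ^ CARD('d)" by simp
    also have "\<dots> \<le> (\<Sum>\<^sub>\<infinity>k. h k) ^ CARD('d)"
      using X assms by (intro power_mono finite_sum_le_infsum sum_nonneg) auto
    finally show "(\<Sum>m\<in>F. \<Prod>i\<in>UNIV. h (m $ i)) \<le> (\<Sum>\<^sub>\<infinity>k. h k) ^ CARD('d)" .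
  qed
qed (auto intro: prod_nonneg nonneg)

text \<open>Since \<open>norm m \<ge> \<bar>m $ i\<bar>\<close>, splitting \<open>(1 + norm m) ^ (d + 1)\<close> into \<open>d\<close> factors
  \<open>(1 + norm m) powr (1 + 1 / d)\<close> reduces the claim to dimension one.\<close>

lemma summable_on_lattice_weight:
  "(\<lambda>m::int ^ 'd. 1 / (1 + norm (lattice_vec m)) ^ (CARD('d) + 1)) summable_on UNIV"
proof (rule summable_on_comparison_test)
  define s where "s = - (1 + 1 / real CARD('d))"
  have "s < -1" by (simp add: s_def)
  then show "(\<lambda>m::int ^ 'd. \<Prod>i\<in>UNIV. (1 + \<bar>real_of_int (m $ i)\<bar>) powr s) summable_on UNIV"
    by (intro summable_on_prod_components summable_on_int_powr) auto
  fix m :: "int ^ 'd"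
  let ?N = "1 + norm (lattice_vec m)"
  have "?N > 0" by (simp add: add_pos_nonneg)
  then have "1 / ?N ^ (CARD('d) + 1) = ?N powr - real (CARD('d) + 1)"
    using powr_realpow[of ?N "CARD('d) + 1"] by (simp only: powr_minus divide_inverse mult_1)
  also have "- real (CARD('d) + 1) = s * real CARD('d)"
    by (simp add: s_def field_simps)
  also have "?N powr (s * real CARD('d)) = (\<Prod>i\<in>(UNIV::'d set). ?N powr s)"
    using \<open>?N > 0\<close> by (simp add: powr_powr[symmetric] powr_realpow)
  also have "\<dots> \<le> (\<Prod>i\<in>UNIV. (1 + \<bar>real_of_int (m $ i)\<bar>) powr s)"
  proof (rule prod_mono)
    fix i :: 'd
    have "\<bar>real_of_int (m $ i)\<bar> \<le> norm (lattice_vec m)"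
      using component_le_norm_cart[of "lattice_vec m" i] by (simp add: lattice_vec_def)
    then have "?N powr s \<le> (1 + \<bar>real_of_int (m $ i)\<bar>) powr s"
      using \<open>s < -1\<close> by (intro powr_mono2') auto
    then show "0 \<le> ?N powr s \<and> ?N powr s \<le> (1 + \<bar>real_of_int (m $ i)\<bar>) powr s" by simp
  qed
  finally show "1 / ?N ^ (CARD('d) + 1) \<le> (\<Prod>i\<in>UNIV. (1 + \<bar>real_of_int (m $ i)\<bar>) powr s)" .
qed auto

lemma has_sum_finite_sum:
  fixes f :: "'i \<Rightarrow> 'a \<Rightarrow> 'b::topological_comm_monoid_add"
  assumes "finite I" and "\<And>i. i \<in> I \<Longrightarrow> (f i has_sum s i) A"
  shows "((\<lambda>x. \<Sum>i\<in>I. f i x) has_sum (\<Sum>i\<in>I. s i)) A"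
  using assms by (induction I rule: finite_induct) (auto intro: has_sum_add)

text \<open>Tonelli for nonnegative terms: summing over \<open>n\<close> first gives
  \<open>a m * infsum K UNIV\<close>, by invariance under translation and reflection, and then the
  order of summation is exchanged.\<close>

lemma
  fixes a K :: "'a::ab_group_add \<Rightarrow> real"
  assumes "a summable_on UNIV" and "K summable_on UNIV"
    and a_nonneg: "\<And>m. a m \<ge> 0" and K_nonneg: "\<And>m. K m \<ge> 0"
  shows summable_on_correlation: "(\<lambda>m. a m * K (m - n)) summable_on UNIV"
    and has_sum_correlation:
      "((\<lambda>n. \<Sum>\<^sub>\<infinity>m. a m * K (m - n)) has_sum (infsum a UNIV * infsum K UNIV)) UNIV"
proof -
  have sum_K: "((\<lambda>n. K (m - n)) has_sum infsum K UNIV) UNIV" for m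
  proof -
    have bij: "bij_betw (\<lambda>n. m - n) UNIV UNIV"
      by (rule bij_betw_byWitness[where f' = "\<lambda>n. m - n"]) auto
    have "(K has_sum infsum K UNIV) UNIV" using assms by (simp add: has_sum_infsum)
    then show ?thesis by (subst has_sum_reindex_bij_betw[OF bij])
  qed
  have inner: "((\<lambda>n. a m * K (m - n)) has_sum (a m * infsum K UNIV)) UNIV" for m
    using sum_K by (rule has_sum_cmult_right)
  have outer: "((\<lambda>m. a m * infsum K UNIV) has_sum (infsum a UNIV * infsum K UNIV)) UNIV"
    using assms by (intro has_sum_cmult_left has_sum_infsum)
  have summable: "(\<lambda>(m, n). a m * K (m - n)) summable_on UNIV \<times> UNIV"
    by (rule summable_on_SigmaI[where g = "\<lambda>m. a m * infsum K UNIV"])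
      (use inner outer a_nonneg K_nonneg in \<open>auto simp: summable_on_def\<close>)
  have "((\<lambda>(m, n). a m * K (m - n)) has_sum (infsum a UNIV * infsum K UNIV)) (UNIV \<times> UNIV)"
    by (rule has_sum_SigmaI[where g = "\<lambda>m. a m * infsum K UNIV"]) (use inner outer summable in auto)
  then have swapped: "((\<lambda>(n, m). a m * K (m - n)) has_sum (infsum a UNIV * infsum K UNIV)) (UNIV \<times> UNIV)"
    by (subst has_sum_swap) simp
  show summable': "(\<lambda>m. a m * K (m - n)) summable_on UNIV" for n
    using summable_on_SigmaD1[of "\<lambda>n m. a m * K (m - n)" UNIV "\<lambda>_. UNIV" n] swapped
    by (auto simp: summable_on_def)
  show "((\<lambda>n. \<Sum>\<^sub>\<infinity>m. a m * K (m - n)) has_sum (infsum a UNIV * infsum K UNIV)) UNIV"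
    by (rule has_sum_SigmaD[OF swapped]) (simp add: has_sum_infsum summable')
qed

lemma sum_abs_le_l1_norm:
  fixes f :: "'a \<Rightarrow> real"
  assumes "in_l1 f" and "finite B"
  shows "(\<Sum>m\<in>B. \<bar>f m\<bar>) \<le> l1_norm f"
  using assms unfolding in_l1_def l1_norm_def real_norm_def by (intro finite_sum_le_infsum) auto

lemma in_l1_diff:
  fixes f g :: "'a \<Rightarrow> 'b::real_normed_vector"
  assumes "in_l1 f" and "in_l1 g"
  shows "in_l1 (\<lambda>n. f n - g n)"
  unfolding in_l1_def
  by (rule summable_on_comparison_test[where f = "\<lambda>n. norm (f n) + norm (g n)"])
    (use assms in \<open>auto simp: in_l1_def intro!: summable_on_add norm_triangle_ineq4\<close>)

subsection \<open>Maximal operators with a summable kernel\<close>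

definition average :: "('a \<Rightarrow> real) \<Rightarrow> 'a set \<Rightarrow> real" where
  "average f B = 1 / real (card B) * (\<Sum>m\<in>B. \<bar>f m\<bar>)"

definition set_max :: "('a \<Rightarrow> 'a set set) \<Rightarrow> ('a \<Rightarrow> real) \<Rightarrow> 'a \<Rightarrow> real" where
  "set_max \<B> f n = (SUP B\<in>\<B> n. average f B)"

lemma average_le_sum: "average f B \<le> (\<Sum>m\<in>B. \<bar>f m\<bar>)"
proof -
  \<comment> \<open>If \<open>card B = 0\<close>, the quotient is \<open>1 / 0 = 0\<close>.\<close>
  have "1 / real (card B) \<le> 1" by (cases "card B") auto
  then show ?thesis
    using mult_right_mono[of "1 / real (card B)" 1 "\<Sum>m\<in>B. \<bar>f m\<bar>"]
    by (simp add: average_def sum_nonneg)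
qed

lemma average_triangle: "average f B \<le> average g B + average (\<lambda>m. f m - g m) B"
proof -
  have "(\<Sum>m\<in>B. \<bar>f m\<bar>) \<le> (\<Sum>m\<in>B. \<bar>g m\<bar>) + (\<Sum>m\<in>B. \<bar>f m - g m\<bar>)"
    unfolding sum.distrib[symmetric] by (rule sum_mono) linarith
  then show ?thesis
    unfolding average_def distrib_left[symmetric] by (intro mult_left_mono) auto
qed

text \<open>These are the only properties of the two operators that enter the l1 estimates. The
  kernel \<open>K\<close> is the same for all \<open>n\<close>, all sets and all directions. Lattice
  vectors of norm one are the basis vectors and their negatives, so \<open>shift\<close> can be
  applied at both ends of an edge.\<close>

locale maximal_family =
  fixes \<B> :: "int ^ 'd \<Rightarrow> (int ^ 'd) set set" and K :: "int ^ 'd \<Rightarrow> real"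
  assumes nonempty: "\<B> n \<noteq> {}"
    and finite: "B \<in> \<B> n \<Longrightarrow> finite B"
    and K_nonneg: "K m \<ge> 0"
    and K_summable: "K summable_on UNIV"
    and shift: "\<lbrakk>B \<in> \<B> n; norm (lattice_vec e) = 1\<rbrakk> \<Longrightarrow>
      \<exists>B'\<in>\<B> (n + e). B \<subseteq> B' \<and> (\<forall>m\<in>B. 1 / real (card B) - 1 / real (card B') \<le> K (m - n))"
begin

lemma average_le_set_max:
  assumes "in_l1 f" and "B \<in> \<B> n"
  shows "average f B \<le> set_max \<B> f n"
  unfolding set_max_def
proof (rule cSUP_upper[OF assms(2)], rule bdd_aboveI2)
  fix B assume "B \<in> \<B> n"
  then show "average f B \<le> l1_norm f"
    using average_le_sum[of f B] sum_abs_le_l1_norm[OF assms(1)] finite by (meson order_trans)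
qed

lemma set_max_le:
  assumes "in_l1 f" and "in_l1 g"
  shows "set_max \<B> f n \<le> set_max \<B> g n + l1_norm (\<lambda>m. f m - g m)"
  unfolding set_max_def[of _ f]
proof (rule cSUP_least[OF nonempty])
  fix B assume B: "B \<in> \<B> n"
  have "average (\<lambda>m. f m - g m) B \<le> l1_norm (\<lambda>m. f m - g m)"
    using average_le_sum sum_abs_le_l1_norm[OF in_l1_diff[OF assms] finite[OF B]] by (rule order_trans)
  with average_le_set_max[OF assms(2) B] average_triangle[of f B g]
  show "average f B \<le> set_max \<B> g n + l1_norm (\<lambda>m. f m - g m)" by linarith
qed

text \<open>Uniform closeness of the maximal functions, which handles the gradients on a finite set
  of lattice points.\<close>

lemma abs_set_max_diff_le:
  assumes "in_l1 f" and "in_l1 g"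
  shows "\<bar>set_max \<B> f n - set_max \<B> g n\<bar> \<le> l1_norm (\<lambda>m. f m - g m)"
  using set_max_le[OF assms, of n] set_max_le[OF assms(2,1), of n]
  by (simp add: l1_norm_def abs_minus_commute abs_le_iff)

section \<open>The summable majorant and the gradient bound\<close>

definition majorant :: "(int ^ 'd \<Rightarrow> real) \<Rightarrow> int ^ 'd \<Rightarrow> real" where
  "majorant f n = (\<Sum>\<^sub>\<infinity>m. \<bar>f m\<bar> * K (m - n))"

lemma majorant_summand_summable:
  assumes "in_l1 f"
  shows "(\<lambda>m. \<bar>f m\<bar> * K (m - n)) summable_on UNIV"
  using assms K_summable K_nonneg by (intro summable_on_correlation) (auto simp: in_l1_def)

lemma has_sum_majorant:
  assumes "in_l1 f"
  shows "(majorant f has_sum (l1_norm f * infsum K UNIV)) UNIV"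
  unfolding majorant_def[abs_def] l1_norm_def real_norm_def
  using assms K_summable K_nonneg by (intro has_sum_correlation) (auto simp: in_l1_def)

lemma majorant_nonneg: "majorant f n \<ge> 0"
  unfolding majorant_def by (intro infsum_nonneg mult_nonneg_nonneg) (auto simp: K_nonneg)

lemma majorant_triangle:
  assumes "in_l1 f" and "in_l1 g"
  shows "majorant f n \<le> majorant g n + majorant (\<lambda>m. f m - g m) n"
proof -
  note s = majorant_summand_summable[OF assms(2), of n]
    majorant_summand_summable[OF in_l1_diff[OF assms], of n]
  have "majorant f n \<le> (\<Sum>\<^sub>\<infinity>m. \<bar>g m\<bar> * K (m - n) + \<bar>f m - g m\<bar> * K (m - n))"
    unfolding majorant_def
  proof (rule infsum_mono)
    show "\<bar>f m\<bar> * K (m - n) \<le> \<bar>g m\<bar> * K (m - n) + \<bar>f m - g m\<bar> * K (m - n)" for m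
      unfolding distrib_right[symmetric] by (intro mult_right_mono K_nonneg) linarith
  qed (use assms s in \<open>auto intro: majorant_summand_summable summable_on_add\<close>)
  also have "\<dots> = majorant g n + majorant (\<lambda>m. f m - g m) n"
    unfolding majorant_def by (rule infsum_add[OF s])
  finally show ?thesis .
qed

text \<open>Change the denominator from \<open>card B\<close> to \<open>card B'\<close>. The main
  part only grows when its sum is extended to \<open>B'\<close>, since the summands are nonnegative,
  and the remainder carries the weights controlled by \<open>shift\<close>.\<close>

lemma set_max_shift_le:
  assumes "in_l1 f" and "norm (lattice_vec e) = 1"
  shows "set_max \<B> f n \<le> set_max \<B> f (n + e) + majorant f n"
  unfolding set_max_def[of _ f n]
proof (rule cSUP_least[OF nonempty])
  fix B assume B: "B \<in> \<B> n"
  obtain B' where B': "B' \<in> \<B> (n + e)" "B \<subseteq> B'"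
    and K: "\<And>m. m \<in> B \<Longrightarrow> 1 / real (card B) - 1 / real (card B') \<le> K (m - n)"
    using shift[OF B assms(2)] by blast
  have "average f B = 1 / real (card B') * (\<Sum>m\<in>B. \<bar>f m\<bar>) +
      (\<Sum>m\<in>B. \<bar>f m\<bar> * (1 / real (card B) - 1 / real (card B')))"
    by (simp add: average_def sum_distrib_left sum.distrib[symmetric] algebra_simps
        flip: sum_subtractf)
  also have "1 / real (card B') * (\<Sum>m\<in>B. \<bar>f m\<bar>) \<le> average f B'"
    unfolding average_def using B' finite[OF B'(1)] by (intro mult_left_mono sum_mono2) auto
  also have "(\<Sum>m\<in>B. \<bar>f m\<bar> * (1 / real (card B) - 1 / real (card B'))) \<le> (\<Sum>m\<in>B. \<bar>f m\<bar> * K (m - n))"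
    by (intro sum_mono mult_left_mono K) auto
  also have "\<dots> \<le> majorant f n"
    unfolding majorant_def using finite[OF B] K_nonneg majorant_summand_summable[OF assms(1)]
    by (intro finite_sum_le_infsum) auto
  also have "average f B' \<le> set_max \<B> f (n + e)"
    by (rule average_le_set_max[OF assms(1) B'(1)])
  finally show "average f B \<le> set_max \<B> f (n + e) + majorant f n" by simp
qed

lemma norm_lattice_axis: "norm (lattice_vec (axis i 1 :: int ^ 'd)) = 1"
proof -
  have "lattice_vec (axis i 1 :: int ^ 'd) = axis i 1"
    by (auto simp: lattice_vec_def vec_eq_iff axis_def)
  then show ?thesis by simp
qed

lemma norm_lattice_uminus: "norm (lattice_vec (- e)) = norm (lattice_vec e)"
proof -
  have "lattice_vec (- e) = - lattice_vec e" by (simp add: lattice_vec_def vec_eq_iff)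
  then show ?thesis by simp
qed

text \<open>For each direction the term at \<open>n\<close> bounds the decrease of the maximal
  function along the edge, and the term at \<open>n + axis i 1\<close> its increase. Summing over
  \<open>i\<close> dominates the Euclidean norm.\<close>

definition grad_majorant :: "(int ^ 'd \<Rightarrow> real) \<Rightarrow> int ^ 'd \<Rightarrow> real" where
  "grad_majorant f n = (\<Sum>i\<in>UNIV. majorant f n + majorant f (n + axis i 1))"

lemma norm_grad_le:
  assumes "in_l1 f"
  shows "norm (discrete_grad (set_max \<B> f) n) \<le> grad_majorant f n"
proof -
  have "\<bar>set_max \<B> f (n + axis i 1) - set_max \<B> f n\<bar> \<le> majorant f n + majorant f (n + axis i 1)" for i
    using set_max_shift_le[OF assms norm_lattice_axis, of n i] majorant_nonneg[of f]
      set_max_shift_le[OF assms, of "- axis i 1" "n + axis i 1"]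
    by (simp add: norm_lattice_axis norm_lattice_uminus abs_le_iff) (smt (verit))
  then show ?thesis
    unfolding grad_majorant_def
    by (intro order_trans[OF norm_le_l1_cart] sum_mono) (simp add: discrete_grad_def)
qed

lemma grad_majorant_nonneg: "grad_majorant f n \<ge> 0"
  unfolding grad_majorant_def by (intro sum_nonneg add_nonneg_nonneg majorant_nonneg)

text \<open>Applied to \<open>F j\<close> and \<open>f\<close>, this replaces the varying majorants
  by a fixed one and an error that is small in l1.\<close>

lemma grad_majorant_triangle:
  assumes "in_l1 f" and "in_l1 g"
  shows "grad_majorant f n \<le> grad_majorant g n + grad_majorant (\<lambda>m. f m - g m) n"
  unfolding grad_majorant_def sum.distrib[symmetric]
proof (rule sum_mono)
  fix i
  show "majorant f n + majorant f (n + axis i 1) \<le> majorant g n + majorant g (n + axis i 1) +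
      (majorant (\<lambda>m. f m - g m) n + majorant (\<lambda>m. f m - g m) (n + axis i 1))"
    using majorant_triangle[OF assms, of n] majorant_triangle[OF assms, of "n + axis i 1"] by linarith
qed

definition grad_const :: real where
  "grad_const = real CARD('d) * (2 * infsum K UNIV)"

text \<open>Translation does not change a sum over the lattice, so each of the
  \<open>CARD('d)\<close> directions contributes twice the total mass of
  \<open>majorant f\<close>.\<close>

lemma has_sum_grad_majorant:
  assumes "in_l1 f"
  shows "(grad_majorant f has_sum (grad_const * l1_norm f)) UNIV"
proof -
  let ?S = "l1_norm f * infsum K UNIV"
  have "((\<lambda>n. majorant f (n + axis i 1)) has_sum ?S) UNIV" for i
  proof -
    have bij: "bij_betw (\<lambda>n::int ^ 'd. n + axis i 1) UNIV UNIV"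
      by (rule bij_betw_byWitness[where f' = "\<lambda>n. n - axis i 1"]) auto
    show ?thesis using has_sum_majorant[OF assms] by (subst has_sum_reindex_bij_betw[OF bij])
  qed
  then have "((\<lambda>n. majorant f n + majorant f (n + axis i 1)) has_sum (?S + ?S)) UNIV" for i
    using has_sum_majorant[OF assms] by (intro has_sum_add)
  then have "(grad_majorant f has_sum (\<Sum>i\<in>(UNIV::'d set). ?S + ?S)) UNIV"
    unfolding grad_majorant_def[abs_def] by (intro has_sum_finite_sum) auto
  then show ?thesis by (simp add: grad_const_def algebra_simps)
qed

lemma grad_set_max_bounded:
  assumes "in_l1 f"
  shows "in_l1 (discrete_grad (set_max \<B> f))"
    and "l1_norm (discrete_grad (set_max \<B> f)) \<le> grad_const * l1_norm f"
proof -
  have H: "grad_majorant f summable_on UNIV" "infsum (grad_majorant f) UNIV = grad_const * l1_norm f"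
    using has_sum_grad_majorant[OF assms] by (auto simp: summable_on_def infsumI)
  show "in_l1 (discrete_grad (set_max \<B> f))"
    unfolding in_l1_def by (rule summable_on_comparison_test[OF H(1)]) (auto intro: norm_grad_le assms)
  then show "l1_norm (discrete_grad (set_max \<B> f)) \<le> grad_const * l1_norm f"
    unfolding in_l1_def l1_norm_def H(2)[unfolded l1_norm_def, symmetric]
    by (intro infsum_mono H norm_grad_le assms)
qed

text \<open>Dominated convergence with varying majorants: outside a finite set the difference of the
  gradients is at most \<open>2 * grad_majorant f\<close> plus a majorant of the error \<open>F j - f\<close>.\<close>

lemma grad_set_max_continuous:
  fixes F :: "nat \<Rightarrow> int ^ 'd \<Rightarrow> real"
  assumes F: "\<And>j. in_l1 (F j)" and f: "in_l1 f"
    and conv: "(\<lambda>j. l1_norm (\<lambda>n. F j n - f n)) \<longlonglongrightarrow> 0"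
  shows "(\<lambda>j. l1_norm (\<lambda>n. discrete_grad (set_max \<B> (F j)) n - discrete_grad (set_max \<B> f) n)) \<longlonglongrightarrow> 0"
proof (rule LIMSEQ_I)
  fix \<epsilon> :: real assume "\<epsilon> > 0"
  define D where "D j n = norm (discrete_grad (set_max \<B> (F j)) n - discrete_grad (set_max \<B> f) n)" for j n
  define E where "E j = (\<lambda>n. F j n - f n)" for j
  have E: "in_l1 (E j)" for j unfolding E_def by (rule in_l1_diff[OF F f])
  have sum_H: "grad_majorant g summable_on A" if "in_l1 g" for g A
    using has_sum_grad_majorant[OF that] by (meson summable_on_def summable_on_subset_banach subset_UNIV)
  have D_sum: "D j summable_on A" for j A
    using in_l1_diff[OF grad_set_max_bounded(1)[OF F] grad_set_max_bounded(1)[OF f], of j]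
    unfolding in_l1_def D_def[abs_def] by (meson summable_on_subset_banach subset_UNIV)
  have D_tail: "D j n \<le> 2 * grad_majorant f n + grad_majorant (E j) n" for j n
    unfolding D_def E_def
    using norm_grad_le[OF F, of j n] norm_grad_le[OF f, of n] grad_majorant_triangle[OF F f, of j n]
      norm_triangle_ineq4[of "discrete_grad (set_max \<B> (F j)) n" "discrete_grad (set_max \<B> f) n"]
    by linarith
  have D_pointwise: "D j n \<le> real CARD('d) * (2 * l1_norm (E j))" for j n
  proof -
    have "D j n \<le> (\<Sum>i\<in>(UNIV::'d set). 2 * l1_norm (E j))"
      unfolding D_def
    proof (intro order_trans[OF norm_le_l1_cart] sum_mono)
      fix i
      show "\<bar>(discrete_grad (set_max \<B> (F j)) n - discrete_grad (set_max \<B> f) n) $ i\<bar> \<le> 2 * l1_norm (E j)"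
        unfolding E_def
        using abs_set_max_diff_le[OF F f, of j n] abs_set_max_diff_le[OF F f, of j "n + axis i 1"]
        by (simp add: discrete_grad_def)
    qed
    then show ?thesis by simp
  qed
  \<comment> \<open>Twice the tail of \<open>grad_majorant f\<close> occurs below, so
    \<open>\<epsilon> / 8\<close> here yields \<open>\<epsilon> / 4\<close> there.\<close>
  obtain A where A: "finite A" "dist (sum (grad_majorant f) A) (infsum (grad_majorant f) UNIV) \<le> \<epsilon> / 8"
    using infsum_finite_approximation[OF sum_H[OF f], of "\<epsilon> / 8"] \<open>\<epsilon> > 0\<close> by auto
  have "infsum (grad_majorant f) UNIV = sum (grad_majorant f) A + infsum (grad_majorant f) (- A)"
    using A(1) infsum_Un_disjoint[OF sum_H[OF f, of A] sum_H[OF f, of "- A"]] by simp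
  then have tail: "infsum (grad_majorant f) (- A) \<le> \<epsilon> / 8"
    using A(2) by (simp add: dist_real_def)
  \<comment> \<open>The first summand collects the pointwise bound over \<open>A\<close>, the second
    the total mass of the error majorant; neither depends on \<open>j\<close>.\<close>
  define L where "L = real (card A) * (real CARD('d) * 2) + grad_const"
  have bound: "l1_norm (\<lambda>n. discrete_grad (set_max \<B> (F j)) n - discrete_grad (set_max \<B> f) n)
      \<le> \<epsilon> / 4 + L * l1_norm (E j)" for j
  proof -
    have "infsum (D j) UNIV = sum (D j) A + infsum (D j) (- A)"
      using A(1) infsum_Un_disjoint[OF D_sum[of j A] D_sum[of j "- A"]] by simp
    also have "sum (D j) A \<le> real (card A) * (real CARD('d) * (2 * l1_norm (E j)))"
      by (rule sum_bounded_above) (rule D_pointwise)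
    also have "infsum (D j) (- A) \<le> (\<Sum>\<^sub>\<infinity>n\<in>- A. 2 * grad_majorant f n + grad_majorant (E j) n)"
      by (intro infsum_mono D_sum D_tail summable_on_add summable_on_cmult_right sum_H f E)
    also have "\<dots> = 2 * infsum (grad_majorant f) (- A) + infsum (grad_majorant (E j)) (- A)"
      by (subst infsum_add) (auto intro!: infsum_cmult_right summable_on_cmult_right sum_H f E)
    also have "infsum (grad_majorant (E j)) (- A) \<le> infsum (grad_majorant (E j)) UNIV"
      by (rule infsum_mono_neutral) (auto intro!: sum_H E grad_majorant_nonneg)
    also have "\<dots> = grad_const * l1_norm (E j)"
      by (rule infsumI[OF has_sum_grad_majorant[OF E]])
    finally show ?thesis
      using tail by (simp add: l1_norm_def D_def[abs_def] L_def algebra_simps)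
  qed
  have "(\<lambda>j. L * l1_norm (E j)) \<longlonglongrightarrow> L * 0"
    unfolding E_def by (intro tendsto_intros conv)
  then have "eventually (\<lambda>j. L * l1_norm (E j) < \<epsilon> / 2) sequentially"
    using \<open>\<epsilon> > 0\<close> by (intro order_tendstoD) auto
  then obtain j0 where j0: "\<And>j. j \<ge> j0 \<Longrightarrow> L * l1_norm (E j) < \<epsilon> / 2"
    by (auto simp: eventually_sequentially)
  show "\<exists>j0. \<forall>j\<ge>j0. norm (l1_norm (\<lambda>n. discrete_grad (set_max \<B> (F j)) n -
      discrete_grad (set_max \<B> f) n) - 0) < \<epsilon>"
  proof (intro exI allI impI)
    fix j assume "j \<ge> j0"
    then have "l1_norm (\<lambda>n. discrete_grad (set_max \<B> (F j)) n - discrete_grad (set_max \<B> f) n) < \<epsilon>"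
      using bound[of j] j0[of j] \<open>\<epsilon> > 0\<close> by linarith
    moreover have "l1_norm (\<lambda>n. discrete_grad (set_max \<B> (F j)) n - discrete_grad (set_max \<B> f) n) \<ge> 0"
      by (simp add: l1_norm_def infsum_nonneg)
    ultimately show "norm (l1_norm (\<lambda>n. discrete_grad (set_max \<B> (F j)) n -
      discrete_grad (set_max \<B> f) n) - 0) < \<epsilon>" by simp
  qed
qed

end

subsection \<open>Counting lattice points in dilates\<close>

lemma lattice_vec_add: "lattice_vec (m + n) = lattice_vec m + lattice_vec n"
  by (simp add: lattice_vec_def vec_eq_iff)

lemma lattice_vec_diff: "lattice_vec (m - n) = lattice_vec m - lattice_vec n"
  by (simp add: lattice_vec_def vec_eq_iff)

text \<open>The closed cells cover the space and their interiors are disjoint, with measure one in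
  both cases. Covering thus bounds counts from below and packing bounds them from above.\<close>

definition cell :: "int ^ 'd \<Rightarrow> (real ^ 'd) set" where
  "cell m = cbox (lattice_vec m) (\<chi> i. real_of_int (m $ i) + 1)"

lemma measure_cell: "measure lebesgue (cell m) = 1"
proof -
  have "cell m \<noteq> {}" unfolding cell_def by (subst interval_ne_empty_cart) (simp add: lattice_vec_def)
  then show ?thesis by (simp add: cell_def content_cbox_cart lattice_vec_def)
qed

lemma measure_interior_cell: "measure lebesgue (interior (cell m)) = 1"
proof -
  have "measure lebesgue (interior (cell m)) = measure lebesgue (cell m)"
    unfolding cell_def by (intro measure_interior negligible_convex_frontier bounded_cbox convex_box)
  then show ?thesis by (simp add: measure_cell)
qed

lemma interior_cells_disjoint: "disjoint_family_on (\<lambda>m. interior (cell m)) A"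
proof (unfold disjoint_family_on_def, intro ballI impI equals0I)
  fix m n :: "int ^ 'd" and y assume "m \<noteq> n" and y: "y \<in> interior (cell m) \<inter> interior (cell n)"
  have "m $ i = n $ i" for i
  proof -
    have "real_of_int (m $ i) < y $ i" "y $ i < real_of_int (m $ i) + 1"
      "real_of_int (n $ i) < y $ i" "y $ i < real_of_int (n $ i) + 1"
      using y by (auto simp: cell_def interior_cbox mem_box_cart lattice_vec_def)
    then show ?thesis by linarith
  qed
  then show False using \<open>m \<noteq> n\<close> by (simp add: vec_eq_iff)
qed

lemma norm_diff_cell:
  fixes m :: "int ^ 'd"
  assumes "y \<in> cell m"
  shows "norm (y - lattice_vec m) \<le> real CARD('d)"
proof -
  have "norm (y - lattice_vec m) \<le> (\<Sum>i\<in>(UNIV::'d set). \<bar>(y - lattice_vec m) $ i\<bar>)"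
    by (rule norm_le_l1_cart)
  also have "\<dots> \<le> (\<Sum>i\<in>(UNIV::'d set). 1)"
    using assms by (intro sum_mono) (auto simp: cell_def mem_box_cart lattice_vec_def abs_le_iff algebra_simps)
  finally show ?thesis by simp
qed

lemma in_cell_floor: "y \<in> cell (\<chi> i. \<lfloor>y $ i\<rfloor>)"
  by (auto simp: cell_def mem_box_cart lattice_vec_def)

section \<open>Decay of differences of reciprocal counts\<close>

lemma power_diff_le:
  fixes p q :: real
  assumes "0 \<le> q" and "q \<le> p"
  shows "p ^ Suc e - q ^ Suc e \<le> real (Suc e) * (p - q) * p ^ e"
proof (induction e)
  case (Suc e)
  have "p ^ Suc (Suc e) - q ^ Suc (Suc e) = p * (p ^ Suc e - q ^ Suc e) + (p - q) * q ^ Suc e"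
    by (simp add: algebra_simps)
  also have "\<dots> \<le> p * (real (Suc e) * (p - q) * p ^ e) + (p - q) * p ^ Suc e"
    using assms Suc by (intro add_mono mult_left_mono power_mono) auto
  also have "\<dots> = real (Suc (Suc e)) * (p - q) * p ^ Suc e" by (simp add: algebra_simps)
  finally show ?case .
qed simp

text \<open>For large \<open>r\<close> the power estimate bounds the difference by a constant times
  \<open>(a + b) / (q ^ d * p)\<close>, where \<open>p = r + b\<close> and \<open>q = r - a\<close>
  are at least \<open>(1 + r) / 4\<close>. For small \<open>r\<close> the difference is at most
  one.\<close>

lemma reciprocal_count_diff_le:
  fixes v a b :: real
  assumes "v > 0" and "a \<ge> 0" and "b \<ge> 0" and "d > 0"
  obtains C where "C \<ge> 0" and
    "\<And>r N N'. \<lbrakk>r \<ge> 0; N \<ge> 1; N' > 0; a \<le> r \<Longrightarrow> v * (r - a) ^ d \<le> N; N' \<le> v * (r + b) ^ d\<rbrakk>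
      \<Longrightarrow> 1 / N - 1 / N' \<le> C / (1 + r) ^ (d + 1)"
proof -
  obtain e where d: "d = Suc e" using assms(4) by (cases d) auto
  \<comment> \<open>\<open>c1\<close> serves the range \<open>1 + r < 2 + 2 * a\<close>. In
    \<open>c2\<close> the power of 4 comes from the lower bound \<open>(1 + r) / 4\<close> for
    \<open>p\<close> and \<open>q\<close>.\<close>
  define c1 c2 where "c1 = (2 + 2 * a) ^ (d + 1)" and "c2 = real d * (a + b) * 4 ^ (d + 1) / v"
  have c: "c1 \<ge> 0" "c2 \<ge> 0" using assms by (auto simp: c1_def c2_def)
  show ?thesis
  proof (rule that[of "c1 + c2"])
    fix r N N' :: real
    assume r: "r \<ge> 0" and N: "N \<ge> 1" "a \<le> r \<Longrightarrow> v * (r - a) ^ d \<le> N"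
      and N': "N' > 0" "N' \<le> v * (r + b) ^ d"
    show "1 / N - 1 / N' \<le> (c1 + c2) / (1 + r) ^ (d + 1)"
    proof (cases "r < 2 * a + 1")
      case True
      have "1 / N \<le> 1" "1 / N' \<ge> 0" using N N' by auto
      then have "1 / N - 1 / N' \<le> 1" by linarith
      also have "1 \<le> c1 / (1 + r) ^ (d + 1)"
        unfolding c1_def power_divide[symmetric] using r True by (intro one_le_power) (auto simp: field_simps)
      also have "\<dots> \<le> (c1 + c2) / (1 + r) ^ (d + 1)" using r c by (intro divide_right_mono) auto
      finally show ?thesis .
    next
      case False
      define p q where "p = r + b" and "q = r - a"
      \<comment> \<open>From \<open>r >= 2 * a + 1\<close> follow \<open>r >= 1\<close> and
        \<open>r - a >= (1 + r) / 2\<close>.\<close>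
      have q: "(1 + r) / 4 \<le> q" "q > 0" "q \<le> p" "(1 + r) / 4 \<le> p" "p > 0"
        using False assms r by (auto simp: p_def q_def)
      have "1 / N \<le> 1 / (v * q ^ d)"
        using N False assms q unfolding q_def by (intro divide_left_mono mult_pos_pos) auto
      moreover have "1 / (v * p ^ d) \<le> 1 / N'"
        using N' assms q unfolding p_def by (intro divide_left_mono mult_pos_pos) auto
      ultimately have "1 / N - 1 / N' \<le> 1 / (v * q ^ d) - 1 / (v * p ^ d)" by linarith
      also have "\<dots> = (p ^ Suc e - q ^ Suc e) / (v * q ^ d * p ^ d)"
        using q assms by (simp add: d field_simps)
      also have "\<dots> \<le> (real (Suc e) * (p - q) * p ^ e) / (v * q ^ d * p ^ d)"
        using q assms by (intro divide_right_mono power_diff_le) auto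
      \<comment> \<open>Here \<open>p - q = a + b\<close>, and \<open>p ^ e\<close> cancels against
        \<open>p ^ d\<close> up to one factor \<open>p\<close>.\<close>
      also have "\<dots> = real d * (a + b) / (v * (q ^ d * p))"
        using q assms by (simp add: d p_def[symmetric] field_simps) (simp add: p_def q_def algebra_simps)
      also have "\<dots> \<le> real d * (a + b) / (v * (((1 + r) / 4) ^ d * ((1 + r) / 4)))"
        using q assms r by (intro divide_left_mono mult_left_mono mult_mono power_mono mult_pos_pos) auto
      also have "\<dots> = c2 / (1 + r) ^ (d + 1)"
        using assms by (simp add: c2_def power_divide field_simps)
      also have "\<dots> \<le> (c1 + c2) / (1 + r) ^ (d + 1)" using r c by (intro divide_right_mono) auto
      finally show ?thesis .
    qed
  qed (use c in auto)
qed

section \<open>Homothets of a convex set and their lattice points\<close>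

definition homothet :: "'a::real_vector set \<Rightarrow> 'a \<Rightarrow> real \<Rightarrow> 'a set" where
  "homothet W x r = (\<lambda>w. r *\<^sub>R w + x) ` W"

text \<open>The weights \<open>r / (r + s)\<close> and \<open>s / (r + s)\<close> form a convex
  combination. Later this turns every bounded displacement of a point or of the centre into an
  increase of the radius.\<close>

lemma homothet_add:
  assumes "convex W" and "r \<ge> 0" and "s \<ge> 0"
    and y: "y \<in> homothet W x r" and z: "z \<in> homothet W x' s"
  shows "y + z \<in> homothet W (x + x') (r + s)"
proof -
  obtain u w where u: "u \<in> W" "y = r *\<^sub>R u + x" and w: "w \<in> W" "z = s *\<^sub>R w + x'"
    using y z by (auto simp: homothet_def)
  show ?thesis
  proof (cases "r + s = 0")
    case True
    then have "r = 0" "s = 0" using assms by linarith+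
    then show ?thesis using u w by (auto simp: homothet_def)
  next
    case False
    define t where "t = (r / (r + s)) *\<^sub>R u + (s / (r + s)) *\<^sub>R w"
    have "t \<in> W"
      unfolding t_def using assms u w False
      by (intro convexD) (auto simp: add_divide_distrib[symmetric])
    moreover have "y + z = (r + s) *\<^sub>R t + (x + x')"
      using False u w by (simp add: t_def scaleR_add_right)
    ultimately show ?thesis by (auto simp: homothet_def)
  qed
qed

text \<open>\<open>\<delta>\<close> and \<open>R\<close> are the radii of an inner and an outer
  ball. \<open>a\<close> is the increase of radius that absorbs a displacement within a unit cell,
  because the homothet of radius \<open>a\<close> about 0 contains the ball of radius
  \<open>CARD('d)\<close>.\<close>

locale convex_body =
  fixes W :: "(real ^ 'd) set" and \<delta> R a :: real
  assumes compact: "compact W" and convex: "convex W"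
    and inner: "\<delta> > 0" "cball 0 \<delta> \<subseteq> W" and outer: "W \<subseteq> cball 0 R"
  defines a_def: "a \<equiv> real CARD('d) / \<delta>"
begin

lemma R_nonneg: "R \<ge> 0"
proof -
  have "(0 :: real ^ 'd) \<in> cball 0 \<delta>" using inner by simp
  then have "(0 :: real ^ 'd) \<in> cball 0 R" using inner outer by blast
  then show ?thesis by simp
qed

lemma in_homothet_0:
  assumes "s \<ge> 0" and "norm z \<le> s * \<delta>"
  shows "z \<in> homothet W 0 s"
proof (cases "s = 0")
  case True
  then have "z = 0" using assms by simp
  moreover have "0 \<in> W" using inner by (simp add: subset_iff)
  ultimately show ?thesis using True by (auto simp: homothet_def image_iff)
next
  case False
  then have "norm (z /\<^sub>R s) \<le> \<delta>"
    using assms by (simp add: divide_simps mult.commute)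
  then have "z /\<^sub>R s \<in> W" using inner(2) by (auto simp: mem_cball_0)
  then show ?thesis using False unfolding homothet_def by (intro image_eqI[of _ _ "z /\<^sub>R s"]) auto
qed

definition points :: "real ^ 'd \<Rightarrow> real \<Rightarrow> (int ^ 'd) set" where
  "points x r = {m. lattice_vec m \<in> homothet W x r}"

lemma a_nonneg: "a \<ge> 0" using inner by (simp add: a_def)

definition vol :: real where "vol = measure lebesgue W"

lemma vol_pos: "vol > 0"
proof -
  have "0 < measure lebesgue (cball (0 :: real ^ 'd) \<delta>)"
    using content_cball_pos[OF inner(1), of "0 :: real ^ 'd"] by simp
  also have "\<dots> \<le> vol"
    unfolding vol_def using inner compact by (intro measure_mono_fmeasurable) (auto intro: lmeasurable_compact)
  finally show ?thesis .
qed

lemma lmeasurable_homothet: "homothet W x r \<in> lmeasurable"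
  unfolding homothet_def
  by (intro lmeasurable_compact compact_continuous_image compact continuous_intros)

lemma measure_homothet: "r \<ge> 0 \<Longrightarrow> measure lebesgue (homothet W x r) = vol * r ^ CARD('d)"
  unfolding homothet_def vol_def by (subst measure_lebesgue_affine) simp

lemma cell_subset_homothet:
  assumes "m \<in> points x r" and "r \<ge> 0"
  shows "cell m \<subseteq> homothet W x (r + a)"
proof
  fix y assume "y \<in> cell m"
  then have "y - lattice_vec m \<in> homothet W 0 a"
    using inner by (intro in_homothet_0 a_nonneg) (simp add: norm_diff_cell a_def)
  then show "y \<in> homothet W x (r + a)"
    using homothet_add[OF convex assms(2) a_nonneg, of "lattice_vec m" x "y - lattice_vec m" 0] assms
    by (simp add: points_def)
qed

text \<open>Packing: the disjoint open cells at the points of \<open>A\<close> all lie in the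
  homothet of radius \<open>r + a\<close>. The bound is stated for a finite subset \<open>A\<close>
  because the finiteness of \<open>points x r\<close> is itself deduced from it.\<close>

lemma card_subset_points_le:
  assumes "A \<subseteq> points x r" and "finite A" and "r \<ge> 0"
  shows "real (card A) \<le> vol * (r + a) ^ CARD('d)"
proof -
  have "real (card A) = (\<Sum>m\<in>A. measure lebesgue (interior (cell m)))"
    by (simp add: measure_interior_cell)
  also have "\<dots> = measure lebesgue (\<Union>m\<in>A. interior (cell m))"
  proof (rule measure_finite_Union[symmetric])
    show "emeasure lebesgue (interior (cell m)) \<noteq> \<infinity>" for m :: "int ^ 'd"
      using emeasure_bounded_finite[of "interior (cell m)"] by (simp add: cell_def interior_cbox)
  qed (use assms interior_cells_disjoint in auto)
  also have "\<dots> \<le> measure lebesgue (homothet W x (r + a))"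
  proof (rule measure_mono_fmeasurable[OF _ _ lmeasurable_homothet])
    show "(\<Union>m\<in>A. interior (cell m)) \<subseteq> homothet W x (r + a)"
      using assms(1,3) by (meson UN_least cell_subset_homothet interior_subset order_trans subsetD)
  qed (use assms in auto)
  also have "\<dots> = vol * (r + a) ^ CARD('d)"
    using assms a_nonneg by (intro measure_homothet) simp
  finally show ?thesis .
qed

lemma finite_points:
  assumes "r \<ge> 0"
  shows "finite (points x r)"
proof (rule ccontr)
  assume inf: "infinite (points x r)"
  obtain k :: nat where k: "vol * (r + a) ^ CARD('d) < real k" using reals_Archimedean2 by blast
  obtain A where "finite A" "card A = k" "A \<subseteq> points x r"
    using infinite_arbitrarily_large[OF inf] by blast
  then show False using card_subset_points_le[of A x r] assms k by simp
qed

lemma card_points_le: "r \<ge> 0 \<Longrightarrow> real (card (points x r)) \<le> vol * (r + a) ^ CARD('d)"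
  by (intro card_subset_points_le[OF order_refl] finite_points)

text \<open>Covering: a point of the homothet of radius \<open>r - a\<close> lies in the cell at its
  floor. The corner of that cell is at distance at most \<open>CARD('d)\<close> and hence belongs to
  \<open>points x r\<close>.\<close>

lemma card_points_ge:
  assumes "a \<le> r"
  shows "vol * (r - a) ^ CARD('d) \<le> real (card (points x r))"
proof -
  have fin: "finite (points x r)" using assms a_nonneg by (simp add: finite_points)
  have cover: "homothet W x (r - a) \<subseteq> (\<Union>m\<in>points x r. cell m)"
  proof
    fix y assume y: "y \<in> homothet W x (r - a)"
    define m where "m = (\<chi> i. \<lfloor>y $ i\<rfloor>)"
    have ym: "y \<in> cell m" unfolding m_def by (rule in_cell_floor)
    then have "lattice_vec m - y \<in> homothet W 0 a"
      using inner by (intro in_homothet_0 a_nonneg) (simp add: norm_diff_cell norm_minus_commute a_def)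
    then have "lattice_vec m \<in> homothet W x r"
      using homothet_add[OF convex _ a_nonneg y, of "lattice_vec m - y" 0] assms by simp
    then show "y \<in> (\<Union>m\<in>points x r. cell m)" using ym by (auto simp: points_def)
  qed
  have "vol * (r - a) ^ CARD('d) = measure lebesgue (homothet W x (r - a))"
    using assms by (simp add: measure_homothet)
  also have "\<dots> \<le> measure lebesgue (\<Union>m\<in>points x r. cell m)"
    using fin by (intro measure_mono_fmeasurable cover fmeasurable.finite_UN fmeasurableD lmeasurable_homothet)
      (auto simp: cell_def)
  also have "\<dots> \<le> (\<Sum>m\<in>points x r. measure lebesgue (cell m))"
    using fin by (intro measure_UNION_le) (auto simp: cell_def)
  also have "\<dots> = real (card (points x r))" by (simp add: measure_cell)
  finally show ?thesis .
qed

lemma points_subset_shift: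
  assumes "r \<ge> 0" and "norm (x' - x) \<le> 1"
  shows "points x r \<subseteq> points x' (r + 1 / \<delta>)"
proof
  fix m assume "m \<in> points x r"
  have "x - x' \<in> homothet W 0 (1 / \<delta>)"
    using inner assms by (intro in_homothet_0) (auto simp: norm_minus_commute)
  \<comment> \<open>Writing 0 as an element of a homothet about \<open>x' - x\<close> moves the
    centre to \<open>x'\<close> in the sum while the lattice point stays fixed.\<close>
  then have "0 \<in> homothet W (x' - x) (1 / \<delta>)"
    by (auto simp: homothet_def image_iff algebra_simps)
  then show "m \<in> points x' (r + 1 / \<delta>)"
    using homothet_add[OF convex assms(1), of "1 / \<delta>" "lattice_vec m" x 0 "x' - x"] inner \<open>m \<in> points x r\<close>
    by (simp add: points_def)
qed

text \<open>For the non-centered operator, where a dilate is enlarged about its fixed centre until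
  it contains the neighbour.\<close>

lemma points_step:
  assumes "r \<ge> 0" and "m \<in> points x r" and "norm (lattice_vec e) \<le> 1"
  shows "m + e \<in> points x (r + 1 / \<delta>)"
proof -
  have "lattice_vec e \<in> homothet W 0 (1 / \<delta>)"
    using inner assms by (intro in_homothet_0) auto
  then show ?thesis
    using homothet_add[OF convex assms(1), of "1 / \<delta>" "lattice_vec m" x "lattice_vec e" 0] inner assms
    by (simp add: points_def lattice_vec_add)
qed

text \<open>Both points come from the ball of radius \<open>R\<close> by the same homothety. The
  estimate serves to convert decay in the radius into decay in \<open>m - n\<close>.\<close>

lemma norm_diff_points:
  assumes "r \<ge> 0" and "m \<in> points x r" and "n \<in> points x r"
  shows "norm (lattice_vec (m - n)) \<le> 2 * R * r"
proof -
  obtain u w where "u \<in> W" "w \<in> W" and eq: "lattice_vec m - lattice_vec n = r *\<^sub>R (u - w)"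
    using assms by (auto simp: points_def homothet_def scaleR_diff_right)
  then have "norm u \<le> R" "norm w \<le> R" using outer by auto
  then have "norm (u - w) \<le> 2 * R" using norm_triangle_ineq4[of u w] by linarith
  then have "r * norm (u - w) \<le> r * (2 * R)" using assms by (intro mult_left_mono)
  then show ?thesis using assms(1) by (simp add: lattice_vec_diff eq mult.commute)
qed

text \<open>The packing and covering bounds feed \<open>reciprocal_count_diff_le\<close>. A second
  centre \<open>x'\<close> lets the centered case move the dilate, while the non-centered case takes
  \<open>x' = x\<close>.\<close>

lemma reciprocal_card_diff_le:
  obtains C where "C \<ge> 0" and
    "\<And>x x' r m n. \<lbrakk>r \<ge> 0; norm (x' - x) \<le> 1; m \<in> points x r; n \<in> points x r\<rbrakk> \<Longrightarrow>
      1 / real (card (points x r)) - 1 / real (card (points x' (r + 1 / \<delta>)))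
        \<le> C * (1 / (1 + norm (lattice_vec (m - n))) ^ (CARD('d) + 1))"
proof -
  \<comment> \<open>The radius grows by \<open>1 / \<delta>\<close> for the larger set and by
    \<open>a\<close> in the packing bound.\<close>
  define b where "b = 1 / \<delta> + a"
  have "b \<ge> 0" using inner a_nonneg by (simp add: b_def)
  obtain C where C: "C \<ge> 0" and bound:
    "\<And>r N N'. \<lbrakk>r \<ge> 0; N \<ge> 1; N' > 0; a \<le> r \<Longrightarrow> vol * (r - a) ^ CARD('d) \<le> N;
        N' \<le> vol * (r + b) ^ CARD('d)\<rbrakk> \<Longrightarrow> 1 / N - 1 / N' \<le> C / (1 + r) ^ (CARD('d) + 1)"
    using reciprocal_count_diff_le[OF vol_pos a_nonneg \<open>b \<ge> 0\<close>, of "CARD('d)"] by auto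
  show ?thesis
  proof (rule that[of "C * (1 + 2 * R) ^ (CARD('d) + 1)"])
    fix x x' r and m n :: "int ^ 'd"
    assume r: "r \<ge> 0" and x': "norm (x' - x) \<le> 1" and m: "m \<in> points x r" and n: "n \<in> points x r"
    have r': "r + 1 / \<delta> \<ge> 0" using r inner by simp
    have card: "card (points x r) > 0" using m finite_points[OF r] by (auto simp: card_gt_0_iff)
    moreover have "card (points x r) \<le> card (points x' (r + 1 / \<delta>))"
      by (intro card_mono finite_points points_subset_shift r r' x')
    ultimately have "1 / real (card (points x r)) - 1 / real (card (points x' (r + 1 / \<delta>)))
        \<le> C / (1 + r) ^ (CARD('d) + 1)"
      using card_points_le[OF r', of x'] card_points_ge r by (intro bound) (auto simp: b_def algebra_simps)
    also have "\<dots> \<le> C * (1 + 2 * R) ^ (CARD('d) + 1) * (1 / (1 + norm (lattice_vec (m - n))) ^ (CARD('d) + 1))"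
    proof -
      let ?t = "norm (lattice_vec (m - n))"
      \<comment> \<open>Since \<open>?t <= 2 * R * r\<close>, powers of \<open>1 + r\<close> may be
        replaced by powers of \<open>1 + ?t\<close> at the cost of the factor
        \<open>(1 + 2 * R) ^ (CARD('d) + 1)\<close>.\<close>
      have "1 + ?t \<le> (1 + 2 * R) * (1 + r)"
        using norm_diff_points[OF r m n] r R_nonneg by (simp add: algebra_simps)
      then have "(1 + ?t) ^ (CARD('d) + 1) \<le> ((1 + 2 * R) * (1 + r)) ^ (CARD('d) + 1)"
        by (intro power_mono) auto
      moreover have "1 + ?t > 0" by (simp add: add_pos_nonneg)
      ultimately have "1 / (1 + r) ^ (CARD('d) + 1) \<le>
          (1 + 2 * R) ^ (CARD('d) + 1) * (1 / (1 + ?t) ^ (CARD('d) + 1))"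
        using r by (simp add: divide_simps power_mult_distrib del: power_Suc power_add)
      then have "C * (1 / (1 + r) ^ (CARD('d) + 1)) \<le>
          C * ((1 + 2 * R) ^ (CARD('d) + 1) * (1 / (1 + ?t) ^ (CARD('d) + 1)))"
        by (rule mult_left_mono[OF _ C])
      then show ?thesis by (simp only: times_divide_eq_right mult_1_right mult.assoc)
    qed
    finally show "1 / real (card (points x r)) - 1 / real (card (points x' (r + 1 / \<delta>)))
        \<le> C * (1 + 2 * R) ^ (CARD('d) + 1) * (1 / (1 + norm (lattice_vec (m - n))) ^ (CARD('d) + 1))" .
  qed (use C R_nonneg in auto)
qed

end

subsection \<open>The two maximal operators\<close>

lemma convex_body_dilate:
  fixes \<Omega> :: "(real ^ 'd) set"
  assumes "bounded \<Omega>" and "convex \<Omega>" and "0 \<in> interior \<Omega>"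
  obtains \<delta> R where "convex_body (closure \<Omega>) \<delta> R"
    and "\<And>x r. r \<ge> 0 \<Longrightarrow> dilate \<Omega> x r = convex_body.points (closure \<Omega>) x r"
proof -
  obtain \<delta> where \<delta>: "\<delta> > 0" "cball 0 \<delta> \<subseteq> \<Omega>"
    using assms(3) by (auto simp: mem_interior_cball)
  obtain R where R: "closure \<Omega> \<subseteq> cball 0 R"
    using assms(1) by (meson bounded_closure bounded_iff mem_cball_0 subsetI)
  have body: "convex_body (closure \<Omega>) \<delta> R"
    using assms \<delta> R closure_subset by unfold_locales (auto simp: compact_closure convex_closure)
  show ?thesis
  proof (rule that[OF body])
    fix x and r :: real assume "r \<ge> 0"
    have "0 \<in> closure \<Omega>" using assms(3) interior_subset closure_subset by blast
    \<comment> \<open>Radius 0, which \<open>dilate\<close> treats separately, agrees with the image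
      \<open>homothet\<close> because the closure is nonempty.\<close>
    then have zero: "homothet (closure \<Omega>) x 0 = {x}" by (auto simp: homothet_def)
    have pos: "y \<in> homothet (closure \<Omega>) x r \<longleftrightarrow> inverse r *\<^sub>R (y - x) \<in> closure \<Omega>" if "r \<noteq> 0" for y
    proof
      assume "inverse r *\<^sub>R (y - x) \<in> closure \<Omega>"
      then show "y \<in> homothet (closure \<Omega>) x r"
        unfolding homothet_def by (rule rev_image_eqI) (use that in simp)
    qed (use that in \<open>auto simp: homothet_def\<close>)
    show "dilate \<Omega> x r = convex_body.points (closure \<Omega>) x r"
      by (cases "r = 0") (auto simp: dilate_def convex_body.points_def[OF body] zero pos)
  qed
qed

text \<open>Placing the centre at \<open>lattice_vec n\<close> absorbs the translation
  \<open>n + m\<close> in \<open>centered_max\<close>, so that both operators take the form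
  \<open>set_max\<close>.\<close>

definition centered_sets :: "(real ^ 'd) set \<Rightarrow> int ^ 'd \<Rightarrow> (int ^ 'd) set set" where
  "centered_sets \<Omega> n = dilate \<Omega> (lattice_vec n) ` {0..}"

definition noncentered_sets :: "(real ^ 'd) set \<Rightarrow> int ^ 'd \<Rightarrow> (int ^ 'd) set set" where
  "noncentered_sets \<Omega> n = (\<lambda>(x, r). dilate \<Omega> x r) ` {(x, r). r \<ge> 0 \<and> n \<in> dilate \<Omega> x r}"

lemma dilate_lattice_vec: "dilate \<Omega> (lattice_vec n) r = (+) n ` dilate \<Omega> 0 r"
proof -
  have "m \<in> dilate \<Omega> (lattice_vec n) r \<longleftrightarrow> m - n \<in> dilate \<Omega> 0 r" for m
    by (simp add: dilate_def lattice_vec_diff)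
  then show ?thesis by (force simp: image_iff)
qed

lemma centered_max_eq: "centered_max \<Omega> f = set_max (centered_sets \<Omega>) f"
proof
  fix n
  have "average f (dilate \<Omega> (lattice_vec n) r) =
      1 / real (num_points \<Omega> 0 r) * (\<Sum>m\<in>dilate \<Omega> 0 r. \<bar>f (n + m)\<bar>)" for r
    unfolding average_def dilate_lattice_vec num_points_def
    by (simp add: card_image sum.reindex)
  then show "centered_max \<Omega> f n = set_max (centered_sets \<Omega>) f n"
    by (simp add: centered_max_def set_max_def centered_sets_def image_image)
qed

lemma noncentered_max_eq: "noncentered_max \<Omega> f = set_max (noncentered_sets \<Omega>) f"
  by (rule ext) (simp add: noncentered_max_def set_max_def noncentered_sets_def image_image
      average_def num_points_def case_prod_unfold)

lemma maximal_families:
  fixes \<Omega> :: "(real ^ 'd) set"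
  assumes "bounded \<Omega>" and "convex \<Omega>" and "0 \<in> interior \<Omega>"
  obtains K where "maximal_family (centered_sets \<Omega>) K" and "maximal_family (noncentered_sets \<Omega>) K"
proof -
  obtain \<delta> R where body: "convex_body (closure \<Omega>) \<delta> R"
    and dilate: "\<And>x r. r \<ge> 0 \<Longrightarrow> dilate \<Omega> x r = convex_body.points (closure \<Omega>) x r"
    using convex_body_dilate[OF assms] by blast
  interpret convex_body "closure \<Omega>" \<delta> R "real CARD('d) / \<delta>" by (fact body) simp
  obtain C where C: "C \<ge> 0" and bound:
    "\<And>x x' r m n. \<lbrakk>r \<ge> 0; norm (x' - x) \<le> 1; m \<in> points x r; n \<in> points x r\<rbrakk> \<Longrightarrow>
      1 / real (card (points x r)) - 1 / real (card (points x' (r + 1 / \<delta>)))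
        \<le> C * (1 / (1 + norm (lattice_vec (m - n))) ^ (CARD('d) + 1))"
    using reciprocal_card_diff_le by blast
  define K :: "int ^ 'd \<Rightarrow> real"
    where "K m = C * (1 / (1 + norm (lattice_vec m)) ^ (CARD('d) + 1))" for m
  have K: "K summable_on UNIV"
    unfolding K_def[abs_def] by (intro summable_on_cmult_right summable_on_lattice_weight)
  have K_nonneg: "K m \<ge> 0" for m
    unfolding K_def by (intro mult_nonneg_nonneg divide_nonneg_nonneg C zero_le_power) auto
  have radius: "r + 1 / \<delta> \<ge> 0" if "r \<ge> 0" for r using that inner by simp
  \<comment> \<open>\<open>bound\<close> compares two points of the same set, so \<open>n\<close>
    has to lie in its own dilates; in the non-centered case admissibility provides this.\<close>
  have center: "n \<in> dilate \<Omega> (lattice_vec n) r" if "r \<ge> 0" for n r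
    using that in_homothet_0[of r 0] inner
    by (auto simp: dilate points_def homothet_def image_iff)
  show ?thesis
  proof (rule that[of K])
    show "maximal_family (centered_sets \<Omega>) K"
    proof
      fix n e :: "int ^ 'd" and B assume "B \<in> centered_sets \<Omega> n" and e: "norm (lattice_vec e) = 1"
      then obtain r where r: "r \<ge> 0" and B: "B = points (lattice_vec n) r"
        by (auto simp: centered_sets_def dilate)
      \<comment> \<open>Recentre at the neighbour and enlarge the radius enough to contain
        \<open>B\<close>.\<close>
      let ?B' = "points (lattice_vec (n + e)) (r + 1 / \<delta>)"
      have "?B' \<in> centered_sets \<Omega> (n + e)"
        unfolding centered_sets_def using radius[OF r] by (metis atLeast_iff dilate image_eqI)
      moreover have dist: "norm (lattice_vec (n + e) - lattice_vec n) \<le> 1"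
        using e by (simp add: lattice_vec_add)
      moreover have "1 / real (card B) - 1 / real (card ?B') \<le> K (m - n)" if "m \<in> B" for m
        using bound[OF r dist, of m n] center[OF r, of n] that r by (simp add: B K_def dilate)
      ultimately show "\<exists>B'\<in>centered_sets \<Omega> (n + e). B \<subseteq> B' \<and>
          (\<forall>m\<in>B. 1 / real (card B) - 1 / real (card B') \<le> K (m - n))"
        using points_subset_shift[OF r dist] B by blast
    qed (auto simp: centered_sets_def K K_nonneg dilate finite_points)
    show "maximal_family (noncentered_sets \<Omega>) K"
    proof
      show "noncentered_sets \<Omega> n \<noteq> {}" for n
        using center[of 0 n] by (auto simp: noncentered_sets_def)
      fix n e :: "int ^ 'd" and B assume "B \<in> noncentered_sets \<Omega> n" and e: "norm (lattice_vec e) = 1"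
      then obtain x r where r: "r \<ge> 0" and B: "B = points x r" and n: "n \<in> points x r"
        by (auto simp: noncentered_sets_def dilate)
      \<comment> \<open>Keep the centre: the enlarged set contains both \<open>B\<close> and
        \<open>n + e\<close>.\<close>
      let ?B' = "points x (r + 1 / \<delta>)"
      have "n + e \<in> ?B'" using points_step[OF r n, of e] e by simp
      then have "?B' \<in> noncentered_sets \<Omega> (n + e)"
        unfolding noncentered_sets_def using radius[OF r]
        by (intro image_eqI[of _ _ "(x, r + 1 / \<delta>)"]) (simp_all add: dilate)
      moreover have "1 / real (card B) - 1 / real (card ?B') \<le> K (m - n)" if "m \<in> B" for m
        using bound[OF r, of x x m n] n that by (simp add: B K_def)
      moreover have "B \<subseteq> ?B'" using points_subset_shift[OF r, of x x] by (simp add: B)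
      ultimately show "\<exists>B'\<in>noncentered_sets \<Omega> (n + e). B \<subseteq> B' \<and>
          (\<forall>m\<in>B. 1 / real (card B) - 1 / real (card B') \<le> K (m - n))"
        by blast
    qed (auto simp: noncentered_sets_def K K_nonneg dilate finite_points)
  qed
qed

theorem theorem1:
  fixes \<Omega> :: "(real ^ 'd::finite) set" and k :: 'd
  assumes "bounded \<Omega>" and "open \<Omega>" and "convex \<Omega>" and "lipschitz_boundary \<Omega>"
    and "0 \<in> interior \<Omega>"
    and "axis k 1 \<in> frontier \<Omega>"
  shows
    "((\<exists>C. \<forall>f. in_l1 f \<longrightarrow>
         in_l1 (discrete_grad (centered_max \<Omega> f)) \<and>
         l1_norm (discrete_grad (centered_max \<Omega> f)) \<le> C * l1_norm f)
      \<and> (\<forall>F f. (\<forall>j::nat. in_l1 (F j)) \<and> in_l1 f \<and>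
           (\<lambda>j. l1_norm (\<lambda>n. F j n - f n)) \<longlonglongrightarrow> 0 \<longrightarrow>
           (\<lambda>j. l1_norm (\<lambda>n. discrete_grad (centered_max \<Omega> (F j)) n
                           - discrete_grad (centered_max \<Omega> f) n)) \<longlonglongrightarrow> 0))
     \<and>
     ((\<exists>C. \<forall>f. in_l1 f \<longrightarrow>
         in_l1 (discrete_grad (noncentered_max \<Omega> f)) \<and>
         l1_norm (discrete_grad (noncentered_max \<Omega> f)) \<le> C * l1_norm f)
      \<and> (\<forall>F f. (\<forall>j::nat. in_l1 (F j)) \<and> in_l1 f \<and>
           (\<lambda>j. l1_norm (\<lambda>n. F j n - f n)) \<longlonglongrightarrow> 0 \<longrightarrow>
           (\<lambda>j. l1_norm (\<lambda>n. discrete_grad (noncentered_max \<Omega> (F j)) n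
                           - discrete_grad (noncentered_max \<Omega> f) n)) \<longlonglongrightarrow> 0))"
proof -
  obtain K where "maximal_family (centered_sets \<Omega>) K" and "maximal_family (noncentered_sets \<Omega>) K"
    by (rule maximal_families[OF assms(1,3,5)])
  then interpret centered: maximal_family "centered_sets \<Omega>" K +
    noncentered: maximal_family "noncentered_sets \<Omega>" K .
  show ?thesis
    unfolding centered_max_eq noncentered_max_eq
    using centered.grad_set_max_bounded noncentered.grad_set_max_bounded
      centered.grad_set_max_continuous noncentered.grad_set_max_continuous
    by blast
qed

end
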